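(* Let $A$ be an associative algebra over a field $k$ that is just infinite dimensional and has no $2$-, $3$-, or $5$-torsion (i.e. the characteristic of $A$ is not $2$, $3$, or $5$). Let $Z$ denote the center of $A$. Then the Lie algebra $[A,A]/(Z\cap[A,A])$ is also just infinite (as a Lie algebra).
   Context: An associative $k$-algebra $A$ is called just infinite dimensional (or just infinite) if $\dim_k A=\infty$ and $\dim_k A/I<\infty$ for every nonzero two-sided ideal $I$ of $A$. For a Lie algebra $L$ over $k$, just infinite means the analogous property: $\dim_k L=\infty$ and $\dim_k L/I<\infty$ for every nonzero Lie ideal $I$ of $L$. For an associative algebra $A$, $A^-$ denotes the Lie algebra on the underlying space of $A$ with product the commutator $[x,y]=xy-yx$, and $[A,A]$ denotes the subalgebra of $A^-$ generated by all elements $[x,y]$ with $x,y\in A$.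
   Formalization: The algebra A is additionally assumed not to be commutative: for commutative A (e.g. k[x] in characteristic 0, which is just infinite) [A,A] = 0, so [A,A]/(Z∩[A,A]) is zero and never just infinite. *)

theory Defs
  imports Complex_Main
begin

text \<open>
  The library's vector spaces live on whole types, which is enough for the associative
  algebra itself but not for subalgebras and quotients. Hence a record with an explicit
  carrier for not necessarily associative, not necessarily unital algebras over a
  field \<open>'k\<close>; for Lie algebras the product is the bracket.
\<close>

record ('k, 'v) alg =
  carrier :: "'v set"
  zero :: 'v
  add :: "'v \<Rightarrow> 'v \<Rightarrow> 'v"
  smult :: "'k \<Rightarrow> 'v \<Rightarrow> 'v"
  mult :: "'v \<Rightarrow> 'v \<Rightarrow> 'v"

locale alg_over_field =
  fixes L :: "('k::field, 'v) alg"
  assumes zero_closed: "zero L \<in> carrier L"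
    and add_closed: "\<lbrakk>x \<in> carrier L; y \<in> carrier L\<rbrakk> \<Longrightarrow> add L x y \<in> carrier L"
    and smult_closed: "x \<in> carrier L \<Longrightarrow> smult L c x \<in> carrier L"
    and mult_closed: "\<lbrakk>x \<in> carrier L; y \<in> carrier L\<rbrakk> \<Longrightarrow> mult L x y \<in> carrier L"
    and add_assoc: "\<lbrakk>x \<in> carrier L; y \<in> carrier L; z \<in> carrier L\<rbrakk> \<Longrightarrow>
      add L (add L x y) z = add L x (add L y z)"
    and add_commute: "\<lbrakk>x \<in> carrier L; y \<in> carrier L\<rbrakk> \<Longrightarrow> add L x y = add L y x"
    and add_zero: "x \<in> carrier L \<Longrightarrow> add L (zero L) x = x"
    and add_inverse: "x \<in> carrier L \<Longrightarrow> \<exists>y\<in>carrier L. add L x y = zero L"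
    and smult_add_right: "\<lbrakk>x \<in> carrier L; y \<in> carrier L\<rbrakk> \<Longrightarrow>
      smult L c (add L x y) = add L (smult L c x) (smult L c y)"
    and smult_add_left: "x \<in> carrier L \<Longrightarrow>
      smult L (c + d) x = add L (smult L c x) (smult L d x)"
    and smult_smult: "x \<in> carrier L \<Longrightarrow> smult L c (smult L d x) = smult L (c * d) x"
    and smult_one: "x \<in> carrier L \<Longrightarrow> smult L 1 x = x"
    and mult_add_left: "\<lbrakk>x \<in> carrier L; y \<in> carrier L; z \<in> carrier L\<rbrakk> \<Longrightarrow>
      mult L (add L x y) z = add L (mult L x z) (mult L y z)"
    and mult_add_right: "\<lbrakk>x \<in> carrier L; y \<in> carrier L; z \<in> carrier L\<rbrakk> \<Longrightarrow>
      mult L x (add L y z) = add L (mult L x y) (mult L x z)"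
    and mult_smult_left: "\<lbrakk>x \<in> carrier L; y \<in> carrier L\<rbrakk> \<Longrightarrow>
      mult L (smult L c x) y = smult L c (mult L x y)"
    and mult_smult_right: "\<lbrakk>x \<in> carrier L; y \<in> carrier L\<rbrakk> \<Longrightarrow>
      mult L x (smult L c y) = smult L c (mult L x y)"

locale lie_algebra = alg_over_field +
  assumes mult_self: "x \<in> carrier L \<Longrightarrow> mult L x x = zero L"
    and jacobi: "\<lbrakk>x \<in> carrier L; y \<in> carrier L; z \<in> carrier L\<rbrakk> \<Longrightarrow>
      add L (add L (mult L x (mult L y z)) (mult L y (mult L z x))) (mult L z (mult L x y))
        = zero L"

definition alg_subspace :: "('k, 'v) alg \<Rightarrow> 'v set \<Rightarrow> bool" where
  "alg_subspace L W \<longleftrightarrow> W \<subseteq> carrier L \<and> zero L \<in> W \<and>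
     (\<forall>x\<in>W. \<forall>y\<in>W. add L x y \<in> W) \<and> (\<forall>c. \<forall>x\<in>W. smult L c x \<in> W)"

definition subalgebra :: "('k, 'v) alg \<Rightarrow> 'v set \<Rightarrow> bool" where
  "subalgebra L W \<longleftrightarrow> alg_subspace L W \<and> (\<forall>x\<in>W. \<forall>y\<in>W. mult L x y \<in> W)"

definition generated_subalgebra :: "('k, 'v) alg \<Rightarrow> 'v set \<Rightarrow> 'v set" where
  "generated_subalgebra L S = \<Inter>{W. subalgebra L W \<and> S \<subseteq> W}"

text \<open>Two-sided ideals; in a Lie algebra these are exactly the Lie ideals.\<close>

definition alg_ideal :: "('k, 'v) alg \<Rightarrow> 'v set \<Rightarrow> bool" where
  "alg_ideal L I \<longleftrightarrow> alg_subspace L I \<and>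
     (\<forall>x\<in>carrier L. \<forall>y\<in>I. mult L x y \<in> I \<and> mult L y x \<in> I)"

definition coset :: "('k, 'v) alg \<Rightarrow> 'v set \<Rightarrow> 'v \<Rightarrow> 'v set" where
  "coset L I x = add L x ` I"

text \<open>
  The unions below run over all representatives; for an ideal \<open>I\<close> every member of
  such a union is the same coset.
\<close>

definition quotient_alg :: "('k, 'v) alg \<Rightarrow> 'v set \<Rightarrow> ('k, 'v set) alg" where
  "quotient_alg L I =
     \<lparr>carrier = coset L I ` carrier L,
      zero = I,
      add = (\<lambda>X Y. \<Union>x\<in>X. \<Union>y\<in>Y. coset L I (add L x y)),
      smult = (\<lambda>c X. \<Union>x\<in>X. coset L I (smult L c x)),
      mult = (\<lambda>X Y. \<Union>x\<in>X. \<Union>y\<in>Y. coset L I (mult L x y))\<rparr>"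

definition alg_span :: "('k, 'v) alg \<Rightarrow> 'v set \<Rightarrow> 'v set" where
  "alg_span L S = \<Inter>{W. alg_subspace L W \<and> S \<subseteq> W}"

definition finite_dim :: "('k, 'v) alg \<Rightarrow> bool" where
  "finite_dim L \<longleftrightarrow> (\<exists>S. finite S \<and> S \<subseteq> carrier L \<and> alg_span L S = carrier L)"

definition just_infinite :: "('k, 'v) alg \<Rightarrow> bool" where
  "just_infinite L \<longleftrightarrow> \<not> finite_dim L \<and>
     (\<forall>I. alg_ideal L I \<and> I \<noteq> {zero L} \<longrightarrow> finite_dim (quotient_alg L I))"

definition just_infinite_lie_algebra :: "('k::field, 'v) alg \<Rightarrow> bool" where
  "just_infinite_lie_algebra L \<longleftrightarrow> lie_algebra L \<and> just_infinite L"

text \<open>Associative algebras, not assumed unital.\<close>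

locale assoc_algebra = vector_space scale
  for scale :: "'k::field \<Rightarrow> 'a::ring \<Rightarrow> 'a" +
  assumes scale_mult_left: "scale c x * y = scale c (x * y)"
    and scale_mult_right: "x * scale c y = scale c (x * y)"

definition assoc_alg :: "('k \<Rightarrow> 'a \<Rightarrow> 'a) \<Rightarrow> ('k, 'a::ring) alg" where
  "assoc_alg scale = \<lparr>carrier = UNIV, zero = 0, add = (+), smult = scale, mult = (*)\<rparr>"

definition minus_alg :: "('k \<Rightarrow> 'a \<Rightarrow> 'a) \<Rightarrow> ('k, 'a::ring) alg" where
  "minus_alg scale =
     \<lparr>carrier = UNIV, zero = 0, add = (+), smult = scale, mult = (\<lambda>x y. x * y - y * x)\<rparr>"

definition alg_center :: "'a::ring set" where
  "alg_center = {z. \<forall>x. z * x = x * z}"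

definition commutator_subalgebra :: "('k \<Rightarrow> 'a \<Rightarrow> 'a) \<Rightarrow> 'a::ring set" where
  "commutator_subalgebra scale =
     generated_subalgebra (minus_alg scale) {x * y - y * x | x y. True}"

definition commutator_lie_alg :: "('k \<Rightarrow> 'a \<Rightarrow> 'a) \<Rightarrow> ('k, 'a::ring) alg" where
  "commutator_lie_alg scale = (minus_alg scale)\<lparr>carrier := commutator_subalgebra scale\<rparr>"

definition no_torsion :: "('k::field \<Rightarrow> 'a \<Rightarrow> 'a::ring) \<Rightarrow> nat \<Rightarrow> bool" where
  "no_torsion scale n \<longleftrightarrow> (\<forall>x. scale (of_nat n) x = 0 \<longrightarrow> x = 0)"

lemma UN_const: "(\<And>a. a \<in> A \<Longrightarrow> f a = C) \<Longrightarrow> x \<in> A \<Longrightarrow> (\<Union>a\<in>A. f a) = C"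
  by auto
lemma UN_UN_const: assumes "\<And>a b. a \<in> A \<Longrightarrow> b \<in> B \<Longrightarrow> f a b = C" "x \<in> A" "y \<in> B"
  shows "(\<Union>a\<in>A. \<Union>b\<in>B. f a b) = C"
  by (intro UN_const[of _ _ _ x] UN_const[of _ _ _ y] assms)

context alg_over_field begin

lemma add_add_swap:
  assumes "x \<in> carrier L" "y \<in> carrier L" "z \<in> carrier L" "w \<in> carrier L"
  shows "add L (add L x y) (add L z w) = add L (add L x z) (add L y w)"
  by (metis add_assoc add_closed add_commute assms)

context fixes I assumes I: "alg_ideal L I" begin

lemma ideal_in_carrier: "i \<in> I \<Longrightarrow> i \<in> carrier L" and ideal_zero: "zero L \<in> I"
  and ideal_add: "i \<in> I \<Longrightarrow> j \<in> I \<Longrightarrow> add L i j \<in> I"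
  and ideal_smult: "i \<in> I \<Longrightarrow> smult L c i \<in> I"
  and ideal_mult_left: "x \<in> carrier L \<Longrightarrow> i \<in> I \<Longrightarrow> mult L x i \<in> I"
  and ideal_mult_right: "x \<in> carrier L \<Longrightarrow> i \<in> I \<Longrightarrow> mult L i x \<in> I"
  using I by (auto simp: alg_ideal_def alg_subspace_def)

lemma smult_zero_left: assumes "x \<in> carrier L" shows "smult L 0 x = zero L"
proof -
  have e: "smult L 0 x = add L (smult L 0 x) (smult L 0 x)"
    using smult_add_left[OF assms, of 0 0] by simp
  obtain y where "y \<in> carrier L" "add L (smult L 0 x) y = zero L"
    using add_inverse smult_closed assms by blast
  then show ?thesis using e
    by (metis add_assoc add_commute add_zero assms smult_closed zero_closed)
qed

lemma add_smult_minus_one: assumes "x \<in> carrier L" shows "add L x (smult L (-1) x) = zero L"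
  using smult_add_left[of x 1 "-1"] smult_zero_left smult_one assms by simp

lemma coset_eq: assumes x: "x \<in> carrier L" and y: "y \<in> coset L I x"
  shows "coset L I y = coset L I x"
proof -
  from y obtain i where i: "i \<in> I" "y = add L x i" by (auto simp: coset_def)
  have "coset L I y \<subseteq> coset L I x"
    using i x ideal_in_carrier ideal_add add_assoc by (auto simp: coset_def)
  moreover have "add L x j \<in> coset L I y" if "j \<in> I" for j
  proof -
    have "add L x j = add L y (add L (smult L (-1) i) j)"
    proof -
      have c: "i \<in> carrier L" "j \<in> carrier L" "smult L (-1) i \<in> carrier L"
        using i that ideal_in_carrier smult_closed by auto
      have "add L i (add L (smult L (-1) i) j) = j"
        using add_assoc[of i "smult L (-1) i" j] c add_smult_minus_one add_zero by simp
      then show ?thesis using i c x add_assoc add_closed by simp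
    qed
    then show ?thesis using that i ideal_add ideal_smult by (auto simp: coset_def)
  qed
  ultimately show ?thesis by (auto simp: coset_def)
qed

lemma self_in_coset: "x \<in> carrier L \<Longrightarrow> x \<in> coset L I x"
  using ideal_zero add_commute add_zero zero_closed by (force simp: coset_def)

lemma quotient_add: assumes x: "x \<in> carrier L" and y: "y \<in> carrier L"
  shows "add (quotient_alg L I) (coset L I x) (coset L I y) = coset L I (add L x y)"
proof -
  have "coset L I (add L a b) = coset L I (add L x y)" if ab: "a \<in> coset L I x" "b \<in> coset L I y" for a b
  proof (rule coset_eq)
    show "add L x y \<in> carrier L" using x y add_closed by auto
    obtain i j where ij: "i \<in> I" "a = add L x i" "j \<in> I" "b = add L y j" using ab by (auto simp: coset_def)
    have "add L a b = add L (add L x y) (add L i j)" unfolding ij by (rule add_add_swap) (use x y ij ideal_in_carrier in blast)+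
    then show "add L a b \<in> coset L I (add L x y)" using ij ideal_add by (auto simp: coset_def)
  qed
  then show ?thesis unfolding quotient_alg_def alg.simps by (rule UN_UN_const[OF _ self_in_coset[OF x] self_in_coset[OF y]])
qed

lemma quotient_smult: assumes x: "x \<in> carrier L"
  shows "smult (quotient_alg L I) c (coset L I x) = coset L I (smult L c x)"
proof -
  have "coset L I (smult L c a) = coset L I (smult L c x)" if "a \<in> coset L I x" for a
  proof (rule coset_eq)
    show "smult L c x \<in> carrier L" using x smult_closed by auto
    show "smult L c a \<in> coset L I (smult L c x)" using that x ideal_in_carrier ideal_smult smult_add_right by (auto simp: coset_def)
  qed
  then show ?thesis unfolding quotient_alg_def alg.simps by (rule UN_const[OF _ self_in_coset[OF x]])
qed

lemma quotient_mult: assumes x: "x \<in> carrier L" and y: "y \<in> carrier L"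
  shows "mult (quotient_alg L I) (coset L I x) (coset L I y) = coset L I (mult L x y)"
proof -
  have "coset L I (mult L a b) = coset L I (mult L x y)" if ab: "a \<in> coset L I x" "b \<in> coset L I y" for a b
  proof (rule coset_eq)
    show "mult L x y \<in> carrier L" using x y mult_closed by auto
    obtain i j where ij: "i \<in> I" "a = add L x i" "j \<in> I" "b = add L y j" using ab by (auto simp: coset_def)
    have "mult L a b = add L (mult L x y) (add L (mult L i y) (mult L (add L x i) j))"
    proof -
      have c: "i \<in> carrier L" "j \<in> carrier L" using ij ideal_in_carrier by auto
      have "mult L a b = add L (mult L (add L x i) y) (mult L (add L x i) j)"
        using ij c x y mult_add_right add_closed by simp
      also have "\<dots> = add L (add L (mult L x y) (mult L i y)) (mult L (add L x i) j)"
        using c x y mult_add_left by simp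
      finally show ?thesis using c x y add_assoc mult_closed add_closed by simp
    qed
    moreover have "add L (mult L i y) (mult L (add L x i) j) \<in> I"
      by (intro ideal_add ideal_mult_left ideal_mult_right add_closed ideal_in_carrier ij x y)
    ultimately show "mult L a b \<in> coset L I (mult L x y)" by (simp add: coset_def)
  qed
  then show ?thesis unfolding quotient_alg_def alg.simps by (rule UN_UN_const[OF _ self_in_coset[OF x] self_in_coset[OF y]])
qed

lemma quotient_carrier: "carrier (quotient_alg L I) = coset L I ` carrier L" by (simp add: quotient_alg_def)
lemma quotient_zero: "zero (quotient_alg L I) = coset L I (zero L)"
proof -
  have "add L (zero L) ` I = id ` I" by (rule image_cong) (auto simp: add_zero ideal_in_carrier)
  then show ?thesis by (simp add: quotient_alg_def coset_def)
qed

lemma quotient_alg_over_field: "alg_over_field (quotient_alg L I)"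
proof (unfold_locales, goal_cases)
  case 6 then show ?case
    by (clarsimp simp: quotient_carrier quotient_add) (simp add: add_commute)
next
  case (8 X) then obtain x where x: "x \<in> carrier L" "X = coset L I x" by (auto simp: quotient_carrier)
  obtain y where "y \<in> carrier L" "add L x y = zero L" using add_inverse x by blast
  then show ?case using x by (force simp: quotient_carrier quotient_zero quotient_add intro: bexI[of _ y])
qed (auto simp: quotient_carrier quotient_zero quotient_add quotient_smult quotient_mult zero_closed add_closed smult_closed mult_closed
     add_assoc add_zero smult_add_right smult_add_left smult_smult smult_one mult_add_left mult_add_right
     mult_smult_left mult_smult_right)
end
end

lemma (in lie_algebra) quotient_lie_algebra: assumes I: "alg_ideal L I" shows "lie_algebra (quotient_alg L I)"
proof -
  interpret q: alg_over_field "quotient_alg L I" by (rule quotient_alg_over_field[OF I])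
  show ?thesis
   apply unfold_locales
   by (auto simp: quotient_carrier[OF I] quotient_zero[OF I] quotient_add[OF I] quotient_mult[OF I] add_closed mult_closed mult_self jacobi)
qed

context assoc_algebra begin
lemma commutator_subalgebra_closed:
  fixes W defines "W \<equiv> commutator_subalgebra scale"
  shows "0 \<in> W" "x \<in> W \<Longrightarrow> y \<in> W \<Longrightarrow> x + y \<in> W" "x \<in> W \<Longrightarrow> scale c x \<in> W" "x*y-y*x \<in> W"
  unfolding W_def commutator_subalgebra_def generated_subalgebra_def subalgebra_def alg_subspace_def minus_alg_def
  by (simp_all, blast)

lemma lie_algebra_commutator: "lie_algebra (commutator_lie_alg scale)"
proof (unfold_locales, goal_cases)
  case (8 x)
  then show ?case using commutator_subalgebra_closed(3)[of x "-1"]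
    by (auto simp: commutator_lie_alg_def minus_alg_def intro!: bexI[of _ "-x"])
qed (auto simp: commutator_subalgebra_closed commutator_lie_alg_def minus_alg_def scale_mult_left scale_mult_right
    scale_right_diff_distrib scale_left_distrib scale_right_distrib add.assoc algebra_simps)

lemma alg_ideal_center: "alg_ideal (commutator_lie_alg scale) (alg_center \<inter> commutator_subalgebra scale)"
  using commutator_subalgebra_closed
  by (auto simp: alg_ideal_def alg_subspace_def commutator_lie_alg_def minus_alg_def alg_center_def
     algebra_simps scale_mult_left scale_mult_right)

lemma lie_algebra_commutator_mod_center: "lie_algebra (quotient_alg (commutator_lie_alg scale) (alg_center \<inter> commutator_subalgebra scale))"
  by (rule lie_algebra.quotient_lie_algebra[OF lie_algebra_commutator alg_ideal_center])

lemma commutator_subalgebra_eq_span: "commutator_subalgebra scale = span {x * y - y * x | x y. True}" (is "?W = span ?S")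
proof
  have "?S \<subseteq> ?W" by (clarify, rule commutator_subalgebra_closed(4))
  moreover have "subspace ?W" unfolding subspace_def
    by (intro conjI ballI allI commutator_subalgebra_closed(1-3))
  ultimately show "span ?S \<subseteq> ?W" by (rule span_minimal)
  have "x * y - y * x \<in> span ?S" for x y by (rule span_base) blast
  then have "subalgebra (minus_alg scale) (span ?S)"
    unfolding subalgebra_def alg_subspace_def minus_alg_def alg.simps
    by (intro conjI ballI allI span_zero span_add span_scale subset_UNIV)
  then show "?W \<subseteq> span ?S" unfolding commutator_subalgebra_def generated_subalgebra_def
    by (intro Inter_lower) (simp add: span_superset)
qed

text \<open>
  For commutative \<open>A\<close> (for example \<open>k[x]\<close>, which is just infinite) the Lie algebra
  \<open>[A,A]/(Z \<inter> [A,A])\<close> is zero, so its being just infinite presupposes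
  that \<open>A\<close> is not commutative.
\<close>

lemma commutative_not_just_infinite:
  assumes c: "\<And>x y::'a. x * y = y * x"
  shows "\<not> just_infinite (quotient_alg (commutator_lie_alg scale) (alg_center \<inter> commutator_subalgebra scale))"
proof -
  have W: "commutator_subalgebra scale = {0}"
  proof -
    have "{x * y - y * x | x y::'a. True} = {0}"
    proof -
      have "x * y - y * x = 0" for x y :: 'a using c[of x y] by simp
      then show ?thesis by auto
    qed
    then show ?thesis unfolding commutator_subalgebra_eq_span by (simp add: span_insert_0)
  qed
  have Z: "alg_center \<inter> {0} = ({0}::'a set)" by (simp add: alg_center_def)
  define Q where "Q = quotient_alg (commutator_lie_alg scale) {0}"
  have car: "carrier Q = {{0}}"
    by (simp add: Q_def quotient_alg_def commutator_lie_alg_def minus_alg_def W coset_def)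
  have sub: "alg_subspace Q {{0}}"
    by (simp add: alg_subspace_def Q_def quotient_alg_def commutator_lie_alg_def minus_alg_def W coset_def)
  have "alg_span Q {{0}} = {{0}}"
  proof (rule equalityI)
    show "alg_span Q {{0}} \<subseteq> {{0}}" unfolding alg_span_def using sub by (intro Inter_lower) simp
    show "{{0}} \<subseteq> alg_span Q {{0}}" unfolding alg_span_def by (intro Inter_greatest) simp
  qed
  then have "finite_dim Q" unfolding finite_dim_def car by (intro exI[of _ "{{0}}"]) simp
  then show ?thesis unfolding just_infinite_def W Z Q_def by (rule contrapos_pn) (rule conjunct1)
qed
end

end

theory Submission
  imports Defs
begin

text \<open>
  A just infinite algebra \<open>A\<close> is prime: if \<open>aAb = 0\<close> with \<open>a, b \<noteq> 0\<close>, then \<open>a\<close> and \<open>b\<close> lie in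
  nonzero ideals \<open>I\<close>, \<open>J\<close> with \<open>IAJ = 0\<close>, their intersection \<open>N\<close> still has finite codimension,
  and \<open>N\<^sup>3 = 0\<close>. Some nonzero \<open>m\<close> then kills \<open>N\<close> from both sides and so generates a
  finite-dimensional ideal, since only finitely many representatives modulo \<open>N\<close> act on it. A
  finite-dimensional ideal of finite codimension contradicts \<open>dim A = \<infinity>\<close>
  (\<open>finite_codim_annihilator_zero\<close>, \<open>just_infinite_prime\<close>).

  The rest follows Herstein's treatment of Lie ideals. Write \<open>L = [A,A]\<close>, \<open>Z\<close> for the center, and
  let \<open>U \<subseteq> A\<close> be a subspace with \<open>[U,L] \<subseteq> U\<close>, not contained in \<open>Z\<close>. The subspace
  \<open>T = {x. [x,A] \<subseteq> U}\<close> is an associative subring with \<open>[T,L] \<subseteq> T\<close>, and \<open>[U,U] \<subseteq> T\<close>. If \<open>T\<close> were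
  commutative, it would be central, hence \<open>[U,U]\<close> would be central, hence \<open>U\<close> itself would be
  central (\<open>lie_stable_abelian_central\<close>, \<open>lie_stable_central_commutators_zero\<close>). So \<open>T\<close> contains a
  commutator \<open>c \<noteq> 0\<close> of two of its elements, and from the corner \<open>cAc \<subseteq> T\<close> one builds a nonzero
  right ideal and then a nonzero two-sided ideal \<open>J\<close> of \<open>A\<close> inside \<open>T\<close>
  (\<open>lie_stable_subring_contains_ideal\<close>). Thus \<open>[J,A] \<subseteq> U\<close>. As \<open>J\<close> has finite codimension in \<open>A\<close>,
  so has \<open>[J,A]\<close> in \<open>L\<close>, and therefore so has \<open>U\<close>. Applied to the preimage \<open>U\<close> in \<open>L\<close> of a nonzero
  Lie ideal of \<open>L/(Z \<inter> L)\<close>, this is the finiteness of the quotients.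

  It remains to see that \<open>L/(Z \<inter> L)\<close> is infinite-dimensional
  (\<open>commutators_mod_center_infinite\<close>). Otherwise the elements \<open>x\<close> acting as zero on \<open>L/(Z \<inter> L)\<close> have
  finite codimension in \<open>A\<close>; such \<open>x\<close> are central, so \<open>Z\<close> is infinite-dimensional. But \<open>Z\<close> also acts
  on \<open>L/(Z \<inter> L)\<close> by multiplication, so some \<open>z \<noteq> 0\<close> in \<open>Z\<close> satisfies \<open>zL \<subseteq> Z\<close>. Cancelling \<open>z\<close>
  gives \<open>L \<subseteq> Z\<close>, which forces \<open>A\<close> to be commutative.
\<close>

section \<open>Commutators and subspaces stable under them\<close>

definition ad :: "'a::ring \<Rightarrow> 'a \<Rightarrow> 'a" where
  "ad x y = x * y - y * x"

lemma ad_mult: "ad x (a * b) = ad x a * b + a * ad x b"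
  and ad_add: "ad x (a + b) = ad x a + ad x b"
  and ad_zero: "ad x 0 = 0"
  and ad_add_left: "ad (x + y) a = ad x a + ad y a"
  and ad_anti: "ad a x = - ad x a"
  and ad_jacobi: "ad (ad x y) a = ad x (ad y a) - ad y (ad x a)"
  by (simp_all add: ad_def algebra_simps)

lemma center_iff_ad: "x \<in> alg_center \<longleftrightarrow> (\<forall>a. ad x a = 0)"
  by (auto simp: alg_center_def ad_def)

context assoc_algebra begin

text \<open>
  Stability is required only under brackets with elements of \<open>[A,A]\<close>, not with all of \<open>A\<close>, and the
  subspace itself need not lie in \<open>[A,A]\<close>: the notion then covers both the preimages of ideals of
  \<open>[A,A]/(Z \<inter> [A,A])\<close> and the subrings of \<open>A\<close> attached to them.
\<close>

definition lie_stable :: "'a set \<Rightarrow> bool" where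
  "lie_stable V \<longleftrightarrow> subspace V \<and> (\<forall>v\<in>V. \<forall>a b. ad v (ad a b) \<in> V)"

lemma lie_stableD:
  assumes "lie_stable V"
  shows "subspace V" and "v \<in> V \<Longrightarrow> ad v (ad a b) \<in> V" and "v \<in> V \<Longrightarrow> ad (ad a b) v \<in> V"
  using assms subspace_neg[of V "ad v (ad a b)"]
  by (auto simp: lie_stable_def ad_anti[of "ad a b" v])

lemma ad_scale: "ad x (scale c a) = scale c (ad x a)"
  and ad_scale_left: "ad (scale c x) a = scale c (ad x a)"
  by (simp_all add: ad_def scale_mult_left scale_mult_right scale_right_diff_distrib)

end

section \<open>Central elements of prime algebras\<close>

locale prime_algebra = assoc_algebra scale
  for scale :: "'k::field \<Rightarrow> 'a::ring \<Rightarrow> 'a" +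
  assumes prime: "\<And>a b :: 'a. (\<And>x. a * x * b = 0) \<Longrightarrow> a = 0 \<or> b = 0"
    and two_torsion_free: "\<And>x :: 'a. x + x = 0 \<Longrightarrow> x = 0"
    and three_torsion_free: "\<And>x :: 'a. x + x + x = 0 \<Longrightarrow> x = 0"
begin

text \<open>
  For a derivation with square zero the Leibniz rule leaves only the mixed term: with \<open>D = ad x\<close>,
  \<open>0 = D\<^sup>2(ab) = 2 D(a) D(b)\<close>. Replacing \<open>b\<close> by \<open>eb\<close> then gives \<open>D(a) e D(b) = 0\<close>, and primeness applies.
\<close>

lemma central_of_ad_ad_zero:
  fixes x :: 'a
  assumes "\<And>a. ad x (ad x a) = 0"
  shows "x \<in> alg_center"
proof -
  have p: "ad x a * ad x b = 0" for a b
  proof (rule two_torsion_free)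
    have "ad x (ad x (a * b)) = ad x a * ad x b + ad x a * ad x b"
      by (simp add: ad_mult ad_add assms)
    then show "ad x a * ad x b + ad x a * ad x b = 0" using assms by simp
  qed
  have "ad x a * e * ad x b = 0" for a e b
  proof -
    have "ad x a * ad x (e * b) = ad x a * ad x e * b + ad x a * e * ad x b"
      by (simp add: ad_mult distrib_left mult.assoc)
    then show ?thesis using p by simp
  qed
  then show ?thesis using prime unfolding center_iff_ad by blast
qed

text \<open>
  With \<open>D = ad x\<close> and \<open>D\<^sup>3 = 0\<close>, expanding \<open>D\<^sup>3(D(a) b) = 0\<close> leaves the single term
  \<open>3 D\<^sup>2(a) D\<^sup>2(b)\<close>.
\<close>

lemma ad_ad_products_zero:
  fixes x a b :: 'a
  assumes "\<And>a. ad x (ad x (ad x a)) = 0"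
  shows "ad x (ad x a) * ad x (ad x b) = 0"
proof (rule three_torsion_free)
  have "ad x (ad x (ad x (ad x a * b))) =
    ad x (ad x a) * ad x (ad x b) + ad x (ad x a) * ad x (ad x b) + ad x (ad x a) * ad x (ad x b)"
    by (simp add: ad_mult ad_add assms)
  then show "ad x (ad x a) * ad x (ad x b) + ad x (ad x a) * ad x (ad x b)
      + ad x (ad x a) * ad x (ad x b) = 0"
    using assms by simp
qed

text \<open>
  Here \<open>(ad x)\<^sup>2\<close> has central values, so \<open>(ad x)\<^sup>3 = 0\<close> and these values square to zero. A central
  element with square zero vanishes in a prime algebra.
\<close>

lemma central_of_ad_commutators_central:
  fixes x :: 'a
  assumes "\<And>a b. ad x (ad a b) \<in> alg_center"
  shows "x \<in> alg_center"
proof (rule central_of_ad_ad_zero)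
  fix a
  have c: "ad x (ad x b) \<in> alg_center" for b using assms .
  have "ad x (ad x (ad x b)) = 0" for b
    using c[of b] by (simp add: alg_center_def ad_def)
  then have sq: "ad x (ad x a) * ad x (ad x a) = 0" by (rule ad_ad_products_zero)
  have "ad x (ad x a) * e * ad x (ad x a) = 0" for e
  proof -
    have "ad x (ad x a) * e = e * ad x (ad x a)" using c[of a] by (simp add: alg_center_def)
    then show ?thesis using sq by (simp add: mult.assoc)
  qed
  then show "ad x (ad x a) = 0" using prime by blast
qed

text \<open>
  For \<open>u \<in> V\<close> the elements \<open>s = (ad u)\<^sup>2(a)\<close> lie in \<open>V\<close> and square to zero. Commutativity of \<open>V\<close>
  makes \<open>[s,[s,l]] = -2 s l s\<close> vanish for every commutator \<open>l\<close>; for \<open>l = [e, s f]\<close> this reads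
  \<open>s e s f s = 0\<close>, whence \<open>s = 0\<close>.
\<close>

lemma lie_stable_abelian_central:
  assumes V: "lie_stable V" and comm: "\<And>u v. u \<in> V \<Longrightarrow> v \<in> V \<Longrightarrow> ad u v = 0"
  shows "V \<subseteq> alg_center"
proof
  fix u assume u: "u \<in> V"
  show "u \<in> alg_center"
  proof (rule central_of_ad_ad_zero)
    fix a
    define s where "s = ad u (ad u a)"
    have s: "s \<in> V" unfolding s_def using lie_stableD(2)[OF V u] .
    have "ad u (ad u (ad u b)) = 0" for b
      using comm[OF u lie_stableD(2)[OF V u]] .
    then have ss: "s * s = 0" unfolding s_def by (rule ad_ad_products_zero)
    have "s * e * s * f * s = 0" for e f
    proof (rule two_torsion_free)
      have sx: "s * (s * x) = 0" for x using ss by (simp flip: mult.assoc)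
      have "ad s (ad s (ad e (s * f))) = - (s * e * s * f * s + s * e * s * f * s)" (is "_ = - ?w")
        unfolding ad_def by (simp add: algebra_simps ss sx)
      moreover have "ad s (ad s (ad e (s * f))) = 0"
        using comm[OF s lie_stableD(2)[OF V s]] .
      ultimately have "- ?w = 0" by (rule trans[OF sym])
      then show "?w = 0" by (simp only: neg_equal_0_iff_equal)
    qed
    then have "s * e * s = 0 \<or> s = 0" for e using prime[of "s * e * s" s] by blast
    then show "ad u (ad u a) = 0" unfolding s_def[symmetric] using prime by blast
  qed
qed

lemma central_mult_cancel:
  fixes z e :: 'a
  assumes "z \<in> alg_center" "z \<noteq> 0" "z * e = 0"
  shows "e = 0"
proof -
  have "z * x * e = 0" for x
    using assms by (metis (mono_tags, lifting) alg_center_def mem_Collect_eq mult.assoc mult_zero_right)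
  then show ?thesis using prime assms(2) by blast
qed

text \<open>
  Let \<open>D = ad u\<close> and suppose that \<open>z = D(v)\<close>, which is central, is not zero. Then \<open>D\<^sup>4 = 0\<close>, and
  \<open>D\<^sup>4(vb) = 4 z D\<^sup>3(b)\<close> shows that already \<open>D\<^sup>3 = 0\<close>. In the same way \<open>D\<^sup>3(vb) = 3 z D\<^sup>2(b)\<close> gives
  \<open>D\<^sup>2 = 0\<close>, so \<open>u\<close> is central and \<open>z = 0\<close> after all.
\<close>

lemma lie_stable_central_commutators_zero:
  assumes V: "lie_stable V" and cen: "\<And>u v. u \<in> V \<Longrightarrow> v \<in> V \<Longrightarrow> ad u v \<in> alg_center"
    and u: "u \<in> V" and v: "v \<in> V"
  shows "ad u v = 0"
proof (rule ccontr)
  assume nz: "ad u v \<noteq> 0"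
  have c: "ad u v \<in> alg_center" using cen u v .
  have dz: "ad u (ad u v) = 0" using c by (simp add: ad_def alg_center_def)
  have "ad u (ad u (ad u b)) \<in> alg_center" for b
    using cen[OF u lie_stableD(2)[OF V u]] .
  then have d4: "ad u (ad u (ad u (ad u b))) = 0" for b
    by (simp add: ad_def alg_center_def)
  have d3: "ad u (ad u (ad u b)) = 0" for b
  proof -
    let ?w = "ad u v * ad u (ad u (ad u b))"
    have "ad u (ad u (ad u (ad u (v * b)))) = (?w + ?w) + (?w + ?w)"
      by (simp add: ad_mult ad_add dz d4 ad_zero)
    then have "?w = 0" using d4 two_torsion_free by metis
    then show ?thesis using central_mult_cancel c nz by blast
  qed
  have d2: "ad u (ad u b) = 0" for b
  proof -
    let ?w = "ad u v * ad u (ad u b)"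
    have "ad u (ad u (ad u (v * b))) = ?w + ?w + ?w"
      by (simp add: ad_mult ad_add dz d3 ad_zero)
    then have "?w = 0" using d3 three_torsion_free by metis
    then show ?thesis using central_mult_cancel c nz by blast
  qed
  then have "u \<in> alg_center" by (rule central_of_ad_ad_zero)
  then show False using nz by (simp add: center_iff_ad)
qed

end

section \<open>Ideals inside stable subrings\<close>

locale noncommutative_prime_algebra = prime_algebra scale
  for scale :: "'k::field \<Rightarrow> 'a::ring \<Rightarrow> 'a" +
  assumes noncommutative: "\<exists>x y :: 'a. x * y \<noteq> y * x"
begin

text \<open>
  If \<open>rx\<close> and \<open>rxy\<close> commute with \<open>a\<close>, then \<open>rx[y,a] = 0\<close>; so a nonzero central right ideal would
  make all commutators vanish. The next lemma is the mirror image.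
\<close>

lemma central_right_multiples_zero:
  fixes r :: 'a
  assumes "\<And>b. r * b \<in> alg_center" 
  shows "r = 0"
proof -
  have rc: "r * x * y * a = a * (r * x * y)" for x y a
    using assms[of "x * y"] by (simp add: alg_center_def mult.assoc)
  have z: "r * x * (y * a - a * y) = 0" for x y a
  proof -
    have "r * x * a = a * (r * x)" using assms[of "x"] by (simp add: alg_center_def)
    then show ?thesis using rc[of x y a] by (simp add: algebra_simps flip: mult.assoc)
  qed
  have "r = 0 \<or> y * a - a * y = 0" for y a :: 'a by (rule prime) (rule z)
  then show ?thesis using noncommutative by auto
qed

lemma central_left_multiples_zero:
  fixes r :: 'a
  assumes "\<And>b. b * r \<in> alg_center"
  shows "r = 0"
proof -
  have z: "(y * a - a * y) * x * r = 0" for x y a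
  proof -
    have 1: "x * r * a = a * (x * r)" using assms[of "x"] by (simp add: alg_center_def)
    have 2: "y * x * r * a = a * (y * x * r)" using assms[of "y * x"] by (simp add: alg_center_def)
    have "(y * a - a * y) * x * r = y * (a * (x * r)) - a * (y * x * r)"
      by (simp add: algebra_simps)
    also have "\<dots> = 0" unfolding 1[symmetric] 2[symmetric] by (simp add: mult.assoc)
    finally show ?thesis .
  qed
  have "y * a - a * y = 0 \<or> r = 0" for y a :: 'a by (rule prime) (rule z)
  then show ?thesis using noncommutative by auto
qed

text \<open>
  Since \<open>[y, yb] = y[y,b]\<close>, the Leibniz rule for \<open>[x, y[y,b]]\<close> puts \<open>[x,y][y,b]\<close> into \<open>T\<close> for
  arbitrary \<open>b\<close>. Taking \<open>b = ax\<close> and expanding \<open>[y,ax]\<close> isolates the corner.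
\<close>

lemma lie_stable_subring_contains_corner:
  assumes T: "lie_stable T" and mult: "\<And>x y. x \<in> T \<Longrightarrow> y \<in> T \<Longrightarrow> x * y \<in> T"
    and x: "x \<in> T" and y: "y \<in> T"
  shows "ad x y * a * ad x y \<in> T"
proof -
  note [simp] = subspace_add[OF lie_stableD(1)[OF T]] subspace_diff[OF lie_stableD(1)[OF T]]
    subspace_neg[OF lie_stableD(1)[OF T]]
  have 1: "ad x y * ad y b \<in> T" for b
  proof -
    have "ad x y * ad y b = ad x (ad y (y * b)) - y * ad x (ad y b)"
      by (simp add: ad_def algebra_simps)
    then show ?thesis using lie_stableD(2)[OF T x] mult[OF y] by simp
  qed
  have "ad x y * a * ad x y = ad x y * ad y a * x - ad x y * ad y (a * x)"
    by (simp add: ad_def algebra_simps)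
  then show ?thesis using 1 mult[OF _ x] by simp
qed

text \<open>
  Suppose that \<open>cTc = 0\<close>. The corner in \<open>T\<close> first yields \<open>c\<^sup>2 = 0\<close>. Then sandwiching
  \<open>[[cec,l],l] \<in> T\<close> between two factors \<open>c\<close> leaves \<open>-2 (clc) e (clc)\<close>, so \<open>clc = 0\<close> for every
  commutator \<open>l\<close>; the choice \<open>l = [a,cb]\<close> gives \<open>cacbc = 0\<close>, whence \<open>c = 0\<close>.
\<close>

lemma corner_not_annihilating:
  assumes T: "lie_stable T" 
    and c: "c \<in> T" "c \<noteq> 0" and corner: "\<And>a. c * a * c \<in> T"
  shows "\<exists>t\<in>T. c * t * c \<noteq> 0"
proof (rule ccontr)
  assume "\<not> ?thesis"
  then have ctc: "c * t * c = 0" if "t \<in> T" for t using that by blast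
  have "(c * c) * a * (c * c) = 0" for a using ctc[OF corner[of a]] by (simp add: mult.assoc)
  then have cc: "c * c = 0" using prime by blast
  then have ccx: "c * (c * x) = 0" for x by (simp flip: mult.assoc)
  have clc: "c * ad a b * c = 0" for a b
  proof -
    define l where "l = ad a b"
    have "(c * l * c) * e * (c * l * c) = 0" for e
    proof (rule two_torsion_free)
      have "ad (ad (c * e * c) l) l \<in> T"
        unfolding l_def using lie_stableD(2)[OF T] corner by blast
      then have "c * ad (ad (c * e * c) l) l * c = 0" by (rule ctc)
      moreover have "c * ad (ad (c * e * c) l) l * c =
          - ((c * l * c) * e * (c * l * c) + (c * l * c) * e * (c * l * c))" (is "_ = - ?w")
        by (simp add: ad_def algebra_simps cc ccx)
      ultimately have "- ?w = 0" by (simp only:)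
      then show "?w = 0" by (simp only: neg_equal_0_iff_equal)
    qed
    then show ?thesis unfolding l_def using prime by blast
  qed
  have "(c * a * c) * b * c = 0" for a b
  proof -
    have "c * ad a (c * b) * c = (c * a * c) * b * c"
      by (simp add: ad_def algebra_simps cc ccx)
    then show ?thesis using clc by simp
  qed
  then have "c * a * c = 0" for a using prime[of "c * a * c" c] c by blast
  then show False using prime[of c c] c by blast
qed

text \<open>
  With \<open>c = [x,y]\<close> and \<open>t \<in> T\<close> such that \<open>ctc \<noteq> 0\<close>, expand \<open>(cqc) t [cpc, l] \<in> T\<close> for a commutator
  \<open>l\<close>: one of the two terms lies in \<open>cAc\<close>, so the other one, \<open>wl\<close> with \<open>w = cqctcpc\<close>, is in \<open>T\<close>.
  Hence multiplication by \<open>w\<close> sends \<open>[A,A]\<close> into \<open>T\<close>. To pass from \<open>[A,A]\<close> to \<open>A\<close>, use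
  \<open>w[a,bw]e = w[a,bwe] - (wbw)[a,e]\<close>, where \<open>wbw\<close> has the same form as \<open>w\<close>: the element
  \<open>r = w[a,bw]\<close> generates a right ideal inside \<open>T\<close>. Were all these \<open>r\<close> zero, the left ideal \<open>Aw\<close>
  would be central.
\<close>

lemma lie_stable_subring_contains_right_ideal:
  assumes T: "lie_stable T" and mult: "\<And>x y. x \<in> T \<Longrightarrow> y \<in> T \<Longrightarrow> x * y \<in> T"
    and x: "x \<in> T" and y: "y \<in> T" and nz: "ad x y \<noteq> 0"
  obtains r where "r \<noteq> 0" "r \<in> T" "\<And>a. r * a \<in> T"
proof -
  note [simp] = subspace_add[OF lie_stableD(1)[OF T]] subspace_diff[OF lie_stableD(1)[OF T]]
  define c where "c = ad x y"
  have corner: "c * a * c \<in> T" for a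
    unfolding c_def by (rule lie_stable_subring_contains_corner[OF T mult x y])
  have "c \<in> T" unfolding c_def ad_def using mult x y by simp
  then obtain t where t: "t \<in> T" "c * t * c \<noteq> 0"
    using corner_not_annihilating[OF T] corner nz c_def by blast
  define M where "M = {c * q * (c * t * c) * p * c | p q. True}"
  have M_L: "w * ad a b \<in> T" if "w \<in> M" for w a b
  proof -
    from that obtain p q where w: "w = c * q * (c * t * c) * p * c" unfolding M_def by blast
    have "w * ad a b = (c * q * c) * t * ad (c * p * c) (ad a b)
        + c * (q * c * t * ad a b * c * p) * c"
      unfolding w ad_def[of _ "ad a b"] by (simp add: algebra_simps)
    moreover have "(c * q * c) * t * ad (c * p * c) (ad a b) \<in> T"
      by (intro mult corner t lie_stableD(2)[OF T])
    ultimately show ?thesis using corner by simp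
  qed
  have M_M: "w * b * w \<in> M" if "w \<in> M" for w b
  proof -
    from that obtain p q where w: "w = c * q * (c * t * c) * p * c" unfolding M_def by blast
    have "w * b * w = c * (q * c * t * c * p * c * b * c * q) * (c * t * c) * p * c"
      unfolding w by (simp add: mult.assoc)
    then show ?thesis unfolding M_def by blast
  qed
  obtain w where w: "w \<in> M" "w \<noteq> 0"
  proof -
    have "c \<noteq> 0" using nz c_def by simp
    then obtain q where "c * q * (c * t * c) \<noteq> 0" using prime[of c "c * t * c"] t by blast
    then obtain p where "c * q * (c * t * c) * p * c \<noteq> 0"
      using prime[of "c * q * (c * t * c)" c] \<open>c \<noteq> 0\<close> by blast
    then show ?thesis using that unfolding M_def by blast
  qed
  \<comment> \<open>From \<open>w[A,A] \<subseteq> T\<close> to a right ideal: the correction term has the same form, as \<open>wbw \<in> M\<close>.\<close>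
  have right: "w * ad a (b * w) * e \<in> T" for a b e
  proof -
    have "w * ad a (b * w) * e = w * ad a (b * w * e) - (w * b * w) * ad a e"
      by (simp add: ad_def algebra_simps)
    then show ?thesis using M_L w(1) M_M[OF w(1)] by simp
  qed
  have "\<exists>a b. w * ad a (b * w) \<noteq> 0"
  proof (rule ccontr)
    assume "\<not> ?thesis"
    then have z: "w * a * (b * w) = w * (b * w) * a" for a b
      by (simp add: ad_def algebra_simps)
    have "w * e * ad a (b * w) = 0" for e a b
    proof -
      have "w * e * ad a (b * w) = w * (e * a) * (b * w) - w * e * (b * w) * a"
        by (simp add: ad_def algebra_simps)
      also have "\<dots> = 0" unfolding z by (simp add: mult.assoc)
      finally show ?thesis .
    qed
    then have "ad a (b * w) = 0" for a b using prime[of w "ad a (b * w)"] w(2) by blast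
    then have "b * w \<in> alg_center" for b unfolding center_iff_ad by (metis ad_anti neg_0_equal_iff_equal)
    then show False using central_left_multiples_zero w(2) by blast
  qed
  then show ?thesis using that M_L[OF w(1)] right by blast
qed

text \<open>
  The largest right ideal \<open>B\<close> of \<open>A\<close> inside \<open>T\<close> is nonzero, and it is closed under multiplication by
  commutators from the left because \<open>ls = sl - [s,l]\<close>. The identity
  \<open>e[s,b]s' = [es,b]s' - [e,b]ss'\<close> then shows that \<open>A[B,A]B \<subseteq> B\<close>, so any nonzero \<open>j\<close> in \<open>[B,A]B\<close>
  will do. If there were none, \<open>B\<close> would be a nonzero central right ideal.
\<close>

lemma lie_stable_subring_contains_ideal:
  assumes T: "lie_stable T" and mult: "\<And>x y. x \<in> T \<Longrightarrow> y \<in> T \<Longrightarrow> x * y \<in> T"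
    and x: "x \<in> T" and y: "y \<in> T" and nz: "ad x y \<noteq> 0"
  obtains j where "j \<noteq> 0" "j \<in> T" "\<And>a. a * j \<in> T" "\<And>b. j * b \<in> T" "\<And>a b. a * j * b \<in> T"
proof -
  note sub = subspace_add[OF lie_stableD(1)[OF T]] subspace_diff[OF lie_stableD(1)[OF T]]
  define B where "B = {r \<in> T. \<forall>a. r * a \<in> T}"
  obtain r where r: "r \<noteq> 0" "r \<in> B"
    using lie_stable_subring_contains_right_ideal[OF assms] unfolding B_def by blast
  have BA: "s * a \<in> B" if "s \<in> B" for s a using that by (simp add: B_def mult.assoc)
  have BD: "s - s' \<in> B" if "s \<in> B" "s' \<in> B" for s s'
    using that sub by (simp add: B_def left_diff_distrib)
  have LB: "ad a b * s \<in> B" if "s \<in> B" for s a b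
  proof -
    have "ad a b * u \<in> T" if "u \<in> B" for u
    proof -
      have "ad a b * u = u * ad a b - ad u (ad a b)" by (simp add: ad_def[of u])
      then show ?thesis using that sub lie_stableD(2)[OF T] by (simp add: B_def)
    qed
    from this[OF that] this[OF BA[OF that]] show ?thesis by (simp add: B_def mult.assoc)
  qed
  have AB: "e * (ad s b * s') \<in> B" if "s \<in> B" "s' \<in> B" for e s b s'
  proof -
    have "e * (ad s b * s') = ad (e * s) b * s' - ad e b * (s * s')"
      by (simp add: ad_def algebra_simps)
    then show ?thesis using BD LB BA that by metis
  qed
  have "\<exists>s\<in>B. \<exists>s'\<in>B. \<exists>b. ad s b * s' \<noteq> 0"
  proof (rule ccontr)
    assume "\<not> ?thesis"
    then have z: "ad s b * s' = 0" if "s \<in> B" "s' \<in> B" for s s' b using that by blast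
    have "ad s a * b * r = 0" if "s \<in> B" for s a b
    proof -
      have "ad s a * b * r = ad s (a * b) * r - a * (ad s b * r)"
        by (simp add: ad_def algebra_simps)
      then show ?thesis using z that r by simp
    qed
    then have "ad s a = 0" if "s \<in> B" for s a using prime[of "ad s a" r] r that by blast
    then have "r * b \<in> alg_center" for b using BA[OF r(2)] center_iff_ad by blast
    then show False using central_right_multiples_zero r(1) by blast
  qed
  then obtain s s' b where j: "s \<in> B" "s' \<in> B" "ad s b * s' \<noteq> 0" by blast
  have "ad s b * s' \<in> B" using LB j(2) .
  moreover have "e * (ad s b * s') \<in> B" for e using AB j by blast
  ultimately show ?thesis using that[OF j(3)] by (simp add: B_def)
qed

text \<open>
  The set \<open>T = {x. [x,A] \<subseteq> U}\<close> is a subring by \<open>[xy,a] = [x,ya] + [y,ax]\<close>, and both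
  \<open>[T,[A,A]] \<subseteq> T\<close> and \<open>[U,U] \<subseteq> T\<close> come from the Jacobi identity. The ideal sought is the largest
  one contained in \<open>T\<close>.
\<close>

theorem noncentral_lie_stable_contains_ideal_commutators:
  assumes U: "lie_stable U" and nc: "\<not> U \<subseteq> alg_center"
  obtains J where "alg_ideal (assoc_alg scale) J" "J \<noteq> {0}" "\<And>x a. x \<in> J \<Longrightarrow> ad x a \<in> U"
proof -
  note sub = lie_stableD(1)[OF U]
  define T where "T = {x. \<forall>a. ad x a \<in> U}"
  have sT: "subspace T" unfolding subspace_def T_def
    using subspace_0[OF sub] subspace_add[OF sub] subspace_scale[OF sub]
    by (auto simp: ad_add_left ad_scale_left ad_def[of 0])
  have T: "lie_stable T" unfolding lie_stable_def
  proof (intro conjI sT ballI allI)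
    fix x a b assume x: "x \<in> T"
    have "ad (ad x (ad a b)) e = ad x (ad (ad a b) e) - ad (ad a b) (ad x e)" for e
      by (rule ad_jacobi)
    moreover have "ad x e \<in> U" for e using x by (simp add: T_def)
    ultimately show "ad x (ad a b) \<in> T"
      using lie_stableD(3)[OF U] subspace_diff[OF sub] by (simp add: T_def)
  qed
  have mult: "x * y \<in> T" if "x \<in> T" "y \<in> T" for x y
  proof -
    have "ad (x * y) a = ad x (y * a) + ad y (a * x)" for a by (simp add: ad_def algebra_simps)
    then show ?thesis using that subspace_add[OF sub] by (simp add: T_def)
  qed
  have UU: "ad u v \<in> T" if "u \<in> U" "v \<in> U" for u v
    using that lie_stableD(2)[OF U] subspace_diff[OF sub] by (simp add: T_def ad_jacobi)
  have "\<exists>x\<in>T. \<exists>y\<in>T. ad x y \<noteq> 0"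
  proof (rule ccontr)
    assume "\<not> ?thesis"
    then have "T \<subseteq> alg_center" using lie_stable_abelian_central[OF T] by blast
    then have "ad u v = 0" if "u \<in> U" "v \<in> U" for u v
      using lie_stable_central_commutators_zero[OF U] UU that by blast
    then show False using lie_stable_abelian_central[OF U] nc by blast
  qed
  then obtain x y where xy: "x \<in> T" "y \<in> T" "ad x y \<noteq> 0" by blast
  obtain j where j: "j \<noteq> 0" "j \<in> T" "\<And>a. a * j \<in> T" "\<And>b. j * b \<in> T" "\<And>a b. a * j * b \<in> T"
    using lie_stable_subring_contains_ideal[OF T mult xy] by blast
  define J where "J = {j \<in> T. (\<forall>a. a * j \<in> T) \<and> (\<forall>b. j * b \<in> T) \<and> (\<forall>a b. a * j * b \<in> T)}"
  have "x * i \<in> J" and "i * x \<in> J" if "i \<in> J" for i x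
  proof -
    have "a * (x * i) = (a * x) * i" "a * (x * i) * b = (a * x) * i * b"
      "(i * x) * b = i * (x * b)" "a * (i * x) = a * i * x" "a * (i * x) * b = a * i * (x * b)" for a b
      by (simp_all add: mult.assoc)
    then show "x * i \<in> J" and "i * x \<in> J" using that unfolding J_def by simp_all
  qed
  moreover have "subspace J" unfolding subspace_def
    using subspace_0[OF sT] subspace_add[OF sT] subspace_scale[OF sT]
    by (simp add: J_def distrib_left distrib_right scale_mult_left scale_mult_right)
  ultimately have "alg_ideal (assoc_alg scale) J"
    by (auto simp: alg_ideal_def alg_subspace_def assoc_alg_def subspace_def)
  moreover have "J \<noteq> {0}" using j unfolding J_def by blast
  moreover have "ad x a \<in> U" if "x \<in> J" for x a using that by (simp add: J_def T_def)
  ultimately show ?thesis using that by blast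
qed

end

section \<open>Subspaces of finite codimension\<close>

context assoc_algebra begin

text \<open>
  The set \<open>W\<close> need not be contained in \<open>X\<close>, and neither set has to be a subspace; for subspaces
  the condition says that \<open>X/(X \<inter> W)\<close> is finite-dimensional.
\<close>

definition finite_codim :: "'a set \<Rightarrow> 'a set \<Rightarrow> bool" where
  "finite_codim X W \<longleftrightarrow> (\<exists>S. finite S \<and> X \<subseteq> span (S \<union> W))"

lemma finite_codim_refl: "finite_codim X X"
  unfolding finite_codim_def using span_superset by (intro exI[of _ "{}"]) auto

lemma finite_codim_mono: "finite_codim X W \<Longrightarrow> W \<subseteq> W' \<Longrightarrow> finite_codim X W'"
  unfolding finite_codim_def by (meson order_refl order_trans span_mono sup.mono)

lemma finite_codim_trans:
  assumes "finite_codim X Y" "finite_codim Y W"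
  shows "finite_codim X W"
proof -
  obtain S S' where S: "finite S" "X \<subseteq> span (S \<union> Y)" and S': "finite S'" "Y \<subseteq> span (S' \<union> W)"
    using assms unfolding finite_codim_def by blast
  have "S \<union> Y \<subseteq> span (S \<union> S' \<union> W)"
    using S' span_mono[of "S' \<union> W" "S \<union> S' \<union> W"] span_superset[of "S \<union> S' \<union> W"] by blast
  then have "span (S \<union> Y) \<subseteq> span (S \<union> S' \<union> W)" by (rule span_minimal[OF _ subspace_span])
  then show ?thesis unfolding finite_codim_def using S S' by (intro exI[of _ "S \<union> S'"]) blast
qed

text \<open>
  If \<open>f\<close> maps \<open>X\<close> into a space that is finite-dimensional modulo \<open>Y\<close>, the kernel of the induced map
  into that quotient has finite codimension. The proof removes the vectors of \<open>F\<close> one at a time; each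
  removal costs at most one dimension.
\<close>

lemma finite_codim_preimage:
  assumes "finite F" and f: "\<And>x y. f (x + y) = f x + f y" "\<And>c x. f (scale c x) = scale c (f x)"
    and "subspace X" and Y: "subspace Y" and "\<And>x. x \<in> X \<Longrightarrow> f x \<in> span (F \<union> Y)"
  shows "finite_codim X {x \<in> X. f x \<in> Y}"
  using assms(1,4,6)
proof (induction F arbitrary: X rule: finite_induct)
  case empty
  then have "{x \<in> X. f x \<in> Y} = X" using Y by (auto simp: span_eq_iff[THEN iffD2])
  then show ?case using finite_codim_refl by simp
next
  case (insert v F)
  define X' where "X' = {x \<in> X. f x \<in> span (F \<union> Y)}"
  have f0: "f 0 = 0" using f(2)[of 0 0] by simp
  have subX': "subspace X'" unfolding subspace_def X'_def
    using insert.prems(1) by (auto simp: f f0 subspace_0 subspace_add subspace_scale span_zero span_add span_scale)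
  \<comment> \<open>One vector \<open>x0\<close> whose image has a nonzero component along \<open>v\<close> suffices to span \<open>X\<close> modulo \<open>X'\<close>.\<close>
  have "finite_codim X X'"
  proof (cases "X' = X")
    case False
    then obtain x0 where x0: "x0 \<in> X" "f x0 \<notin> span (F \<union> Y)" unfolding X'_def by blast
    have br: "\<exists>k. f x - scale k v \<in> span (F \<union> Y)" if "x \<in> X" for x
      using insert.prems(2)[OF that] span_breakdown_eq[of "f x" v "F \<union> Y"] by simp
    obtain k0 where k0: "f x0 - scale k0 v \<in> span (F \<union> Y)" using br x0 by blast
    then have "k0 \<noteq> 0" using x0 by auto
    have "x \<in> span ({x0} \<union> X')" if x: "x \<in> X" for x
    proof -
      obtain k where k: "f x - scale k v \<in> span (F \<union> Y)" using br x by blast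
      \<comment> \<open>The multiple of \<open>x0\<close> is chosen to cancel the component of \<open>f x\<close> along \<open>v\<close>.\<close>
      let ?y = "x + scale (- k / k0) x0"
      have "f ?y = (f x - scale k v) + scale (- k / k0) (f x0 - scale k0 v)"
        unfolding f scale_right_diff_distrib using \<open>k0 \<noteq> 0\<close> by simp
      then have "f ?y \<in> span (F \<union> Y)" using k k0 span_add span_scale by metis
      moreover have "?y \<in> X" using insert.prems(1) x x0 subspace_add subspace_scale by metis
      ultimately have "?y \<in> X'" by (simp add: X'_def)
      then have "?y \<in> span ({x0} \<union> X')" by (intro span_base) simp
      moreover have "scale (k / k0) x0 \<in> span ({x0} \<union> X')" by (intro span_scale span_base) simp
      ultimately have "?y + scale (k / k0) x0 \<in> span ({x0} \<union> X')" by (rule span_add)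
      then show ?thesis by simp
    qed
    then show ?thesis unfolding finite_codim_def by (intro exI[of _ "{x0}"]) auto
  qed (simp add: finite_codim_refl)
  moreover have "finite_codim X' {x \<in> X'. f x \<in> Y}"
    using insert.IH[OF subX'] by (simp add: X'_def)
  moreover have "{x \<in> X'. f x \<in> Y} = {x \<in> X. f x \<in> Y}"
    using span_superset[of "F \<union> Y"] by (auto simp: X'_def)
  ultimately show ?case using finite_codim_trans by simp
qed

lemma finite_codim_preimages:
  assumes "finite E" and F: "finite F"
    and f: "\<And>e x y. f e (x + y) = f e x + f e y" "\<And>e c x. f e (scale c x) = scale c (f e x)"
    and X: "subspace X" and Y: "subspace Y"
    and into: "\<And>e x. e \<in> E \<Longrightarrow> x \<in> X \<Longrightarrow> f e x \<in> span (F \<union> Y)"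
  shows "finite_codim X {x \<in> X. \<forall>e\<in>E. f e x \<in> Y}"
  using assms(1) into
proof (induction E rule: finite_induct)
  case empty
  then show ?case by (simp add: finite_codim_refl)
next
  case (insert e E)
  define X' where "X' = {x \<in> X. \<forall>e\<in>E. f e x \<in> Y}"
  have f0: "f e 0 = 0" for e using f(2)[of e 0 0] by simp
  have "subspace X'" unfolding subspace_def X'_def
    using X Y by (auto simp: f f0 subspace_0 subspace_add subspace_scale)
  then have "finite_codim X' {x \<in> X'. f e x \<in> Y}"
    using insert.prems by (intro finite_codim_preimage[OF F f _ Y]) (auto simp: X'_def)
  moreover have "finite_codim X X'" unfolding X'_def using insert by blast
  moreover have "{x \<in> X'. f e x \<in> Y} = {x \<in> X. \<forall>e\<in>insert e E. f e x \<in> Y}"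
    by (auto simp: X'_def)
  ultimately show ?case using finite_codim_trans by simp
qed

end

section \<open>Quotient algebras and their dimension\<close>

context alg_over_field begin

lemma alg_span_eq_carrier_iff:
  assumes "X \<subseteq> carrier L"
  shows "alg_span L X = carrier L \<longleftrightarrow> (\<forall>W. alg_subspace L W \<and> X \<subseteq> W \<longrightarrow> carrier L \<subseteq> W)"
proof -
  have "alg_subspace L (carrier L)"
    by (auto simp: alg_subspace_def zero_closed add_closed smult_closed)
  then have "alg_span L X \<subseteq> carrier L" using assms unfolding alg_span_def by blast
  then show ?thesis unfolding alg_span_def by blast
qed

context fixes I assumes I: "alg_ideal L I" begin

lemma alg_subspace_preimage:
  assumes "alg_subspace (quotient_alg L I) W"
  shows "alg_subspace L {x \<in> carrier L. coset L I x \<in> W}"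
  using assms
  by (auto simp: alg_subspace_def zero_closed add_closed smult_closed
      quotient_zero[OF I] quotient_add[OF I, symmetric] quotient_smult[OF I, symmetric])

lemma alg_ideal_preimage:
  assumes "alg_ideal (quotient_alg L I) W"
  shows "alg_ideal L {x \<in> carrier L. coset L I x \<in> W}"
  using assms alg_subspace_preimage[of W]
  by (auto simp: alg_ideal_def mult_closed quotient_carrier[OF I] quotient_mult[OF I, symmetric])

lemma alg_subspace_image:
  assumes "alg_subspace L W"
  shows "alg_subspace (quotient_alg L I) (coset L I ` W)"
proof -
  have W: "W \<subseteq> carrier L" "zero L \<in> W" "x \<in> W \<Longrightarrow> y \<in> W \<Longrightarrow> add L x y \<in> W" "x \<in> W \<Longrightarrow> smult L c x \<in> W" for x y c
    using assms by (auto simp: alg_subspace_def)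
  have "add (quotient_alg L I) (coset L I x) (coset L I y) = coset L I (add L x y)" if "x \<in> W" "y \<in> W" for x y
    using quotient_add[OF I] W that by blast
  moreover have "smult (quotient_alg L I) c (coset L I x) = coset L I (smult L c x)" if "x \<in> W" for c x
    using quotient_smult[OF I] W that by blast
  ultimately show ?thesis using W
    by (auto simp: alg_subspace_def quotient_carrier[OF I] quotient_zero[OF I])
qed

text \<open>
  This expresses the dimension of a quotient inside the algebra itself, by a span. It allows
  arguments about quotients to be carried out in \<open>A\<close> instead of on cosets.
\<close>

lemma finite_dim_quotient_iff:
  "finite_dim (quotient_alg L I) \<longleftrightarrow>
    (\<exists>S. finite S \<and> S \<subseteq> carrier L \<and> alg_span L (S \<union> I) = carrier L)"
proof -
  interpret q: alg_over_field "quotient_alg L I" by (rule quotient_alg_over_field[OF I])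
  have Ic: "I \<subseteq> carrier L" using ideal_in_carrier[OF I] by blast
  show ?thesis
  proof
    assume "finite_dim (quotient_alg L I)"
    then obtain S' where S': "finite S'" "S' \<subseteq> coset L I ` carrier L"
      "alg_span (quotient_alg L I) S' = carrier (quotient_alg L I)"
      unfolding finite_dim_def quotient_carrier[OF I] by blast
    then obtain S where S: "S \<subseteq> carrier L" "finite S" "S' = coset L I ` S"
      by (meson finite_subset_image)
    have "carrier L \<subseteq> W" if W: "alg_subspace L W" "S \<union> I \<subseteq> W" for W
    proof
      fix x assume x: "x \<in> carrier L"
      have Wc: "W \<subseteq> carrier L" using W(1) by (simp add: alg_subspace_def)
      have "S' \<subseteq> coset L I ` W" using W(2) S(3) by blast
      then have "carrier (quotient_alg L I) \<subseteq> coset L I ` W"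
        using S' alg_subspace_image[OF W(1)] q.alg_span_eq_carrier_iff[of S']
        by (simp add: quotient_carrier[OF I])
      then obtain w where w: "w \<in> W" "coset L I x = coset L I w"
        using x by (auto simp: quotient_carrier[OF I])
      then obtain i where "i \<in> I" "x = add L w i"
        using self_in_coset[OF I x] unfolding coset_def by auto
      then show "x \<in> W" using w W by (auto simp: alg_subspace_def)
    qed
    then have "alg_span L (S \<union> I) = carrier L"
      by (simp add: alg_span_eq_carrier_iff S(1) Ic)
    then show "\<exists>S. finite S \<and> S \<subseteq> carrier L \<and> alg_span L (S \<union> I) = carrier L"
      by (intro exI[of _ S] conjI S(1,2))
  next
    assume "\<exists>S. finite S \<and> S \<subseteq> carrier L \<and> alg_span L (S \<union> I) = carrier L"
    then obtain S where S: "finite S" "S \<subseteq> carrier L" "alg_span L (S \<union> I) = carrier L" by blast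
    have "carrier (quotient_alg L I) \<subseteq> W"
      if W: "alg_subspace (quotient_alg L I) W" "coset L I ` S \<subseteq> W" for W
    proof -
      have "coset L I i \<in> W" if "i \<in> I" for i
      proof -
        have "i \<in> coset L I (zero L)"
          using that add_zero ideal_in_carrier[OF I] by (force simp: coset_def)
        then have "coset L I i = coset L I (zero L)" using coset_eq[OF I zero_closed] by blast
        then show ?thesis using W(1) by (simp add: alg_subspace_def quotient_zero[OF I])
      qed
      then have "S \<union> I \<subseteq> {x \<in> carrier L. coset L I x \<in> W}" using S Ic W by blast
      then have "carrier L \<subseteq> {x \<in> carrier L. coset L I x \<in> W}"
        using alg_subspace_preimage[OF W(1)] S alg_span_eq_carrier_iff[of "S \<union> I"] Ic by simp
      then show ?thesis by (auto simp: quotient_carrier[OF I])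
    qed
    moreover have Sc: "coset L I ` S \<subseteq> carrier (quotient_alg L I)"
      unfolding quotient_carrier[OF I] using S(2) by (rule image_mono)
    ultimately have "alg_span (quotient_alg L I) (coset L I ` S) = carrier (quotient_alg L I)"
      by (simp add: q.alg_span_eq_carrier_iff)
    then show "finite_dim (quotient_alg L I)"
      unfolding finite_dim_def
      by (intro exI[of _ "coset L I ` S"] conjI finite_imageI S(1) Sc)
  qed
qed

text \<open>
  The third isomorphism theorem, as far as it concerns finite dimension: only the preimage of \<open>W\<close> in
  \<open>L\<close> matters.
\<close>

lemma finite_dim_quotient_quotient:
  assumes W: "alg_ideal (quotient_alg L I) W"
    and S: "finite S" "S \<subseteq> carrier L"
    and sp: "alg_span L (S \<union> {x \<in> carrier L. coset L I x \<in> W}) = carrier L" (is "alg_span L (S \<union> ?U) = _")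
  shows "finite_dim (quotient_alg (quotient_alg L I) W)"
proof -
  interpret q: alg_over_field "quotient_alg L I" by (rule quotient_alg_over_field[OF I])
  have Wc: "W \<subseteq> carrier (quotient_alg L I)" using q.ideal_in_carrier[OF W] by blast
  have Sc: "coset L I ` S \<subseteq> carrier (quotient_alg L I)" using S by (auto simp: quotient_carrier[OF I])
  have "carrier (quotient_alg L I) \<subseteq> V"
    if V: "alg_subspace (quotient_alg L I) V" "coset L I ` S \<union> W \<subseteq> V" for V
  proof -
    have "S \<union> ?U \<subseteq> {x \<in> carrier L. coset L I x \<in> V}" using S V by blast
    then have "carrier L \<subseteq> {x \<in> carrier L. coset L I x \<in> V}"
      using alg_subspace_preimage[OF V(1)] sp S alg_span_eq_carrier_iff[of "S \<union> ?U"] by simp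
    then show ?thesis by (auto simp: quotient_carrier[OF I])
  qed
  then have "alg_span (quotient_alg L I) (coset L I ` S \<union> W) = carrier (quotient_alg L I)"
    by (simp add: q.alg_span_eq_carrier_iff Sc Wc)
  then show ?thesis unfolding q.finite_dim_quotient_iff[OF W]
    by (intro exI[of _ "coset L I ` S"] conjI finite_imageI S(1) Sc)
qed

end
end

section \<open>Just infinite algebras are prime\<close>

context assoc_algebra begin

lemma alg_over_field_assoc_alg: "alg_over_field (assoc_alg scale)"
proof (unfold_locales, goal_cases)
  case (8 x)
  then show ?case by (auto simp: assoc_alg_def intro!: exI[of _ "- x"])
qed (auto simp: assoc_alg_def scale_mult_left scale_mult_right scale_left_distrib
    scale_right_distrib algebra_simps)

lemma alg_span_assoc_alg: "alg_span (assoc_alg scale) X = span X"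
proof -
  have "alg_subspace (assoc_alg scale) W \<longleftrightarrow> subspace W" for W
    by (auto simp: alg_subspace_def assoc_alg_def subspace_def)
  then show ?thesis by (simp add: alg_span_def span_def hull_def)
qed

lemma just_infinite_assoc_iff:
  "just_infinite (assoc_alg scale) \<longleftrightarrow> \<not> finite_codim UNIV {0} \<and>
    (\<forall>I. alg_ideal (assoc_alg scale) I \<and> I \<noteq> {0} \<longrightarrow> finite_codim UNIV I)"
proof -
  interpret A: alg_over_field "assoc_alg scale" by (rule alg_over_field_assoc_alg)
  have c: "carrier (assoc_alg scale) = UNIV" "zero (assoc_alg scale) = 0"
    by (simp_all add: assoc_alg_def)
  have "finite_dim (assoc_alg scale) \<longleftrightarrow> finite_codim UNIV {0}"
    by (auto simp: finite_dim_def finite_codim_def c alg_span_assoc_alg)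
  moreover have "finite_dim (quotient_alg (assoc_alg scale) I) \<longleftrightarrow> finite_codim UNIV I"
    if "alg_ideal (assoc_alg scale) I" for I
    using A.finite_dim_quotient_iff[OF that]
    by (auto simp: finite_codim_def c alg_span_assoc_alg)
  ultimately show ?thesis by (auto simp: just_infinite_def c)
qed

lemma alg_ideal_assoc_alg_iff:
  "alg_ideal (assoc_alg scale) I \<longleftrightarrow> subspace I \<and> (\<forall>i\<in>I. \<forall>x. x * i \<in> I \<and> i * x \<in> I)"
  by (auto simp: alg_ideal_def alg_subspace_def assoc_alg_def subspace_def)

lemma span_bound:
  assumes "x \<in> span S" "\<And>s. s \<in> S \<Longrightarrow> f s \<in> P" "subspace P"
    and f: "\<And>x y. f (x + y) = f x + f y" "\<And>c x. f (scale c x) = scale c (f x)"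
  shows "f x \<in> P"
proof -
  have "f 0 = 0" using f(2)[of 0 0] by simp
  then have "subspace {x. f x \<in> P}" using assms(3) unfolding subspace_def by (simp add: f)
  then show ?thesis using span_minimal[of S "{x. f x \<in> P}"] assms(1,2) by blast
qed

text \<open>
  The ideal generated by \<open>m\<close> is spanned by the elements \<open>m\<close>, \<open>sm\<close>, \<open>ms\<close> and \<open>smt\<close>, where \<open>s\<close> and \<open>t\<close>
  run through finitely many representatives modulo \<open>N\<close>. If \<open>m \<noteq> 0\<close>, this ideal is nonzero and
  finite-dimensional, and hence of finite codimension; that makes \<open>A\<close> finite-dimensional.
\<close>

lemma finite_codim_annihilator_zero:
  assumes ji: "just_infinite (assoc_alg scale)"
    and N: "finite_codim UNIV N" and m: "\<And>n. n \<in> N \<Longrightarrow> m * n = 0" "\<And>n. n \<in> N \<Longrightarrow> n * m = 0"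
  shows "m = 0"
proof (rule ccontr)
  assume m0: "m \<noteq> 0"
  obtain S where S: "finite S" "span (S \<union> N) = UNIV" using N unfolding finite_codim_def by blast
  define G where "G = {m} \<union> (\<lambda>s. s * m) ` S \<union> (\<lambda>s. m * s) ` S \<union> (\<lambda>(s, t). s * m * t) ` (S \<times> S)"
  define P where "P = span G"
  have subP: "subspace P" unfolding P_def by (rule subspace_span)
  have GP: "g \<in> P" if "g \<in> G" for g unfolding P_def using that by (rule span_base)
  note lin = distrib_left distrib_right scale_mult_left scale_mult_right
  have all: "f x \<in> P" if "\<And>s. s \<in> S \<Longrightarrow> f s \<in> P" "\<And>n. n \<in> N \<Longrightarrow> f n = 0"
    and "\<And>x y. f (x + y) = f x + f y" "\<And>c x. f (scale c x) = scale c (f x)" for f x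
    by (rule span_bound[of x "S \<union> N"]) (use that S subP subspace_0[OF subP] in auto)
  have xm: "x * m \<in> P" for x by (rule all) (auto simp: lin m G_def intro: GP)
  have mx: "m * x \<in> P" for x by (rule all) (auto simp: lin m G_def intro: GP)
  have smx: "s * m * x \<in> P" if "s \<in> S" for s x
  proof (rule all[where f = "\<lambda>x. s * m * x"])
    show "s * m * t \<in> P" if "t \<in> S" for t
      by (rule GP) (use \<open>s \<in> S\<close> that in \<open>force simp: G_def\<close>)
  qed (simp_all add: lin m mult.assoc)
  have xmy: "x * m * y \<in> P" for x y
    by (rule all[where f = "\<lambda>x. x * m * y"]) (simp_all add: lin m smx)
  have xPx: "x * g \<in> P \<and> g * x \<in> P" if g: "g \<in> G" for x g
  proof -
    consider "g = m" | s where "g = s * m" | s where "g = m * s" | s t where "g = s * m * t"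
      using g unfolding G_def by auto
    then show ?thesis
    proof cases
      case 1
      then show ?thesis using xm mx by simp
    next
      case 2
      then show ?thesis using xm[of "x * s"] xmy[of s x] by (simp add: mult.assoc)
    next
      case 3
      then show ?thesis using mx[of "s * x"] xmy[of x s] by (simp add: mult.assoc)
    next
      case 4
      then show ?thesis using xmy[of "x * s" t] xmy[of s "t * x"] by (simp add: mult.assoc)
    qed
  qed
  have "x * p \<in> P" if "p \<in> P" for x p
    by (rule span_bound[of p G "\<lambda>p. x * p"]) (use that subP xPx in \<open>simp_all add: lin P_def\<close>)
  moreover have "p * x \<in> P" if "p \<in> P" for x p
    by (rule span_bound[of p G "\<lambda>p. p * x"]) (use that subP xPx in \<open>simp_all add: lin P_def\<close>)
  ultimately have "alg_ideal (assoc_alg scale) P" by (simp add: alg_ideal_assoc_alg_iff subP)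
  moreover have "P \<noteq> {0}" using GP[of m] m0 by (auto simp: G_def)
  ultimately have "finite_codim UNIV P" using ji by (simp add: just_infinite_assoc_iff)
  moreover have "finite_codim P {0}" unfolding finite_codim_def P_def
    using S by (intro exI[of _ G]) (auto simp: G_def intro: subsetD[OF span_mono])
  ultimately show False using ji finite_codim_trans by (auto simp: just_infinite_assoc_iff)
qed

text \<open>
  The intersection \<open>N\<close> of the ideals \<open>I = {x. xAb = 0}\<close> and \<open>J = {z. IAz = 0}\<close> has finite codimension
  and satisfies \<open>N\<^sup>3 = 0\<close>. Every product of two elements of \<open>N\<close> annihilates \<open>N\<close>, so it is zero; but
  then every element of \<open>N\<close> annihilates \<open>N\<close>, so \<open>N = 0\<close>.
\<close>

theorem just_infinite_prime:
  fixes a b :: 'a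
  assumes ji: "just_infinite (assoc_alg scale)" and ab: "\<And>x. a * x * b = 0"
  shows "a = 0 \<or> b = 0"
proof (rule ccontr)
  assume "\<not> ?thesis"
  then have nz: "a \<noteq> 0" "b \<noteq> 0" by auto
  note lin = distrib_left distrib_right scale_mult_left scale_mult_right
  define I where "I = {x. \<forall>y. x * y * b = 0}"
  define J where "J = {z. \<forall>x\<in>I. \<forall>y. x * y * z = 0}"
  have I: "alg_ideal (assoc_alg scale) I"
    unfolding alg_ideal_assoc_alg_iff
  proof (intro conjI ballI allI)
    show "subspace I" by (simp add: I_def subspace_def lin)
  next
    fix i x assume i: "i \<in> I"
    then have "i * (x * y) * b = 0" "i * y * b = 0" for y unfolding I_def by blast+
    then show "x * i \<in> I" "i * x \<in> I" unfolding I_def by (simp_all add: mult.assoc)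
  qed
  have J: "alg_ideal (assoc_alg scale) J"
    unfolding alg_ideal_assoc_alg_iff
  proof (intro conjI ballI allI)
    show "subspace J" by (simp add: J_def subspace_def lin)
  next
    fix i x assume i: "i \<in> J"
    then have z: "j * (y * x) * i = 0" "j * y * i = 0" if "j \<in> I" for j y
      using that unfolding J_def by blast+
    have "j * y * (x * i) = 0" "j * y * (i * x) = 0" if "j \<in> I" for j y
      using z[OF that, of y] by (simp_all flip: mult.assoc)
    then show "x * i \<in> J" "i * x \<in> J" unfolding J_def by simp_all
  qed
  have "a \<in> I" using ab by (simp add: I_def)
  then have I0: "I \<noteq> {0}" using nz by auto
  have "b \<in> J" by (simp add: J_def I_def)
  then have J0: "J \<noteq> {0}" using nz by auto
  have fI: "finite_codim UNIV I" and "finite_codim UNIV J"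
    using ji I J I0 J0 by (auto simp: just_infinite_assoc_iff)
  then obtain S where "finite S" "span (S \<union> J) = UNIV" unfolding finite_codim_def by blast
  then have "finite_codim I {x \<in> I. x \<in> J}"
    using I J by (intro finite_codim_preimage[where F = S and f = "\<lambda>x. x"])
      (auto simp: alg_ideal_assoc_alg_iff)
  then have fN: "finite_codim UNIV (I \<inter> J)"
    using finite_codim_trans[OF fI] by (simp add: Int_def)
  have NNN: "p * q * r = 0" if "p \<in> I \<inter> J" "q \<in> I \<inter> J" "r \<in> I \<inter> J" for p q r
    using that by (auto simp: J_def)
  have "p * q = 0" if "p \<in> I \<inter> J" "q \<in> I \<inter> J" for p q
  proof (rule finite_codim_annihilator_zero[OF ji fN])
    show "p * q * n = 0" if "n \<in> I \<inter> J" for n using NNN that \<open>p \<in> I \<inter> J\<close> \<open>q \<in> I \<inter> J\<close> by blast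
    show "n * (p * q) = 0" if "n \<in> I \<inter> J" for n
      using NNN[of n p q] that \<open>p \<in> I \<inter> J\<close> \<open>q \<in> I \<inter> J\<close> by (simp add: mult.assoc)
  qed
  then have "p = 0" if "p \<in> I \<inter> J" for p
    using finite_codim_annihilator_zero[OF ji fN] that by blast
  then have "I \<inter> J \<subseteq> {0}" by blast
  then show False using fN ji finite_codim_mono by (auto simp: just_infinite_assoc_iff)
qed

section \<open>The Lie algebra of commutators modulo the center\<close>

lemma commutator_lie_alg_simps:
  "carrier (commutator_lie_alg scale) = commutator_subalgebra scale"
  "zero (commutator_lie_alg scale) = 0"
  "add (commutator_lie_alg scale) x y = x + y"
  "smult (commutator_lie_alg scale) c x = scale c x"
  "mult (commutator_lie_alg scale) x y = ad x y"
  by (simp_all add: commutator_lie_alg_def minus_alg_def ad_def)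

lemma commutator_subalgebra_span_ad: "commutator_subalgebra scale = span {ad x y | x y. True}"
  by (simp add: commutator_subalgebra_eq_span ad_def)

lemma ad_in_commutator_subalgebra: "ad x y \<in> commutator_subalgebra scale"
  unfolding commutator_subalgebra_span_ad by (intro span_base) blast

lemma subspace_center: "subspace alg_center"
  by (auto simp: subspace_def alg_center_def algebra_simps scale_mult_left scale_mult_right)

lemma subspace_commutator_subalgebra: "subspace (commutator_subalgebra scale)"
  unfolding commutator_subalgebra_span_ad by (rule subspace_span)

lemma alg_subspace_commutator_iff:
  "alg_subspace (commutator_lie_alg scale) W \<longleftrightarrow> subspace W \<and> W \<subseteq> commutator_subalgebra scale"
  by (auto simp: alg_subspace_def commutator_lie_alg_simps subspace_def)

lemma alg_span_commutator_eq_carrier_iff: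
  assumes "X \<subseteq> commutator_subalgebra scale"
  shows "alg_span (commutator_lie_alg scale) X = carrier (commutator_lie_alg scale) \<longleftrightarrow>
    commutator_subalgebra scale \<subseteq> span X"
proof -
  interpret L: lie_algebra "commutator_lie_alg scale" by (rule lie_algebra_commutator)
  have X: "span X \<subseteq> commutator_subalgebra scale"
    using assms subspace_commutator_subalgebra by (rule span_minimal)
  have "alg_span (commutator_lie_alg scale) X = carrier (commutator_lie_alg scale) \<longleftrightarrow>
    (\<forall>W. subspace W \<and> W \<subseteq> commutator_subalgebra scale \<and> X \<subseteq> W \<longrightarrow>
      commutator_subalgebra scale \<subseteq> W)"
    using L.alg_span_eq_carrier_iff[of X] assms
    by (simp add: alg_subspace_commutator_iff commutator_lie_alg_simps(1))
  also have "\<dots> \<longleftrightarrow> commutator_subalgebra scale \<subseteq> span X"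
  proof
    show "commutator_subalgebra scale \<subseteq> span X"
      if "\<forall>W. subspace W \<and> W \<subseteq> commutator_subalgebra scale \<and> X \<subseteq> W \<longrightarrow>
        commutator_subalgebra scale \<subseteq> W"
      using that X subspace_span span_superset by blast
    show "\<forall>W. subspace W \<and> W \<subseteq> commutator_subalgebra scale \<and> X \<subseteq> W \<longrightarrow>
        commutator_subalgebra scale \<subseteq> W"
      if "commutator_subalgebra scale \<subseteq> span X"
      using that by (meson order_trans span_minimal)
  qed
  finally show ?thesis .
qed

text \<open>
  Write \<open>A = span F + J\<close> with \<open>F\<close> finite. By bilinearity \<open>[A,A]\<close> is spanned by the finitely many
  commutators of elements of \<open>F\<close> together with \<open>[J,A]\<close>.
\<close>

lemma finite_codim_commutators:
  assumes J: "finite_codim UNIV J" and U: "subspace U" and JU: "\<And>x a. x \<in> J \<Longrightarrow> ad x a \<in> U"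
  obtains S where "finite S" "S \<subseteq> commutator_subalgebra scale"
    "commutator_subalgebra scale \<subseteq> span (S \<union> U)"
proof -
  obtain F where F: "finite F" "span (F \<union> J) = UNIV" using J unfolding finite_codim_def by blast
  define S where "S = (\<lambda>(s, t). ad s t) ` (F \<times> F)"
  let ?P = "span (S \<union> U)"
  have UP: "u \<in> U \<Longrightarrow> u \<in> ?P" for u by (intro span_base) simp
  have 1: "ad s y \<in> ?P" if "s \<in> F" for s y
  proof (rule span_bound[of y "F \<union> J"])
    fix t assume t: "t \<in> F \<union> J"
    show "ad s t \<in> ?P"
    proof (cases "t \<in> F")
      case True
      then show ?thesis using that by (intro span_base) (auto simp: S_def)
    next
      case False
      then have "ad t s \<in> U" using t JU by blast
      then show ?thesis using UP subspace_neg[OF U] by (metis ad_anti)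
    qed
  qed (use F in \<open>auto simp: ad_add ad_scale\<close>)
  have "ad x y \<in> ?P" for x y
    by (rule span_bound[of x "F \<union> J" "\<lambda>x. ad x y"])
      (use F 1 UP JU in \<open>auto simp: ad_add_left ad_scale_left\<close>)
  then have "commutator_subalgebra scale \<subseteq> ?P"
    unfolding commutator_subalgebra_span_ad by (intro span_minimal) auto
  moreover have "finite S" "S \<subseteq> commutator_subalgebra scale"
    using F by (auto simp: S_def ad_in_commutator_subalgebra)
  ultimately show ?thesis using that by blast
qed

end

context noncommutative_prime_algebra begin

text \<open>
  Suppose that \<open>V = L/(Z \<inter> L)\<close> is finite-dimensional, where \<open>L = [A,A]\<close>. The adjoint action of \<open>A\<close> on
  \<open>V\<close> has a kernel of finite codimension, and this kernel is central by
  \<open>central_of_ad_commutators_central\<close>; so \<open>Z\<close> is infinite-dimensional. Hence the action of \<open>Z\<close> on \<open>V\<close>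
  by multiplication also has a nonzero kernel. For a nonzero \<open>z\<close> in it, \<open>zL \<subseteq> Z\<close>, and cancelling \<open>z\<close>
  in \<open>z[l,e] = [zl,e] = 0\<close> makes all commutators \<open>l\<close> central, so that \<open>(ad x)\<^sup>2 = 0\<close> for every \<open>x\<close>.
\<close>

theorem commutators_mod_center_infinite:
  assumes inf: "\<not> finite_codim UNIV {0}"
    and S: "finite S" "S \<subseteq> commutator_subalgebra scale"
  shows "\<not> commutator_subalgebra scale \<subseteq> span (S \<union> (alg_center \<inter> commutator_subalgebra scale))"
proof
  let ?L = "commutator_subalgebra scale" and ?Z = "alg_center :: 'a set"
  assume fin: "?L \<subseteq> span (S \<union> (?Z \<inter> ?L))"
  then have finZ: "?L \<subseteq> span (S \<union> ?Z)" using span_mono[of "S \<union> (?Z \<inter> ?L)" "S \<union> ?Z"] by blast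
  \<comment> \<open>The kernel of the adjoint action of \<open>A\<close> on \<open>L/(Z \<inter> L)\<close>; finitely many \<open>l\<close> suffice to test it.\<close>
  have "finite_codim UNIV {x \<in> UNIV. \<forall>l\<in>S. ad x l \<in> ?Z}"
    using ad_in_commutator_subalgebra finZ
    by (intro finite_codim_preimages[OF S(1) S(1)])
      (auto simp: ad_add_left ad_scale_left subspace_center)
  moreover have "{x \<in> UNIV. \<forall>l\<in>S. ad x l \<in> ?Z} \<subseteq> ?Z"
  proof
    fix x assume "x \<in> {x \<in> UNIV. \<forall>l\<in>S. ad x l \<in> ?Z}"
    then have x: "l \<in> S \<Longrightarrow> ad x l \<in> ?Z" for l by blast
    have z: "ad x l = 0" if "l \<in> ?Z" for l using that by (simp add: alg_center_def ad_def)
    have "ad x l \<in> ?Z" if "l \<in> ?L" for l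
      by (rule span_bound[of l "S \<union> ?Z"])
        (use that finZ x z subspace_0[OF subspace_center] in \<open>auto simp: ad_add ad_scale subspace_center\<close>)
    then show "x \<in> ?Z" using central_of_ad_commutators_central ad_in_commutator_subalgebra by blast
  qed
  ultimately have codimZ: "finite_codim UNIV ?Z" by (rule finite_codim_mono)
  have ZL: "z * l \<in> ?L" if z: "z \<in> ?Z" and l: "l \<in> ?L" for z l
  proof (rule span_bound[of l "{ad x y | x y. True}" "\<lambda>l. z * l"])
    fix s assume "s \<in> {ad x y | x y :: 'a. True}"
    then obtain x y where "s = ad x y" by blast
    moreover have "z * ad x y = ad (z * x) y"
      using z by (simp add: alg_center_def ad_def algebra_simps)
    ultimately show "z * s \<in> ?L" using ad_in_commutator_subalgebra by metis
  qed (use l subspace_commutator_subalgebra in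
      \<open>simp_all add: commutator_subalgebra_span_ad distrib_left scale_mult_right\<close>)
  \<comment> \<open>The kernel of the action of \<open>Z\<close> on \<open>L/(Z \<inter> L)\<close> by multiplication.\<close>
  have "finite_codim ?Z {z \<in> ?Z. \<forall>l\<in>S. z * l \<in> ?Z}"
    using ZL S(2) finZ
    by (intro finite_codim_preimages[OF S(1) S(1)])
      (auto simp: distrib_right scale_mult_left subspace_center)
  then have "finite_codim UNIV {z \<in> ?Z. \<forall>l\<in>S. z * l \<in> ?Z}"
    using codimZ finite_codim_trans by blast
  then have "\<not> {z \<in> ?Z. \<forall>l\<in>S. z * l \<in> ?Z} \<subseteq> {0}" using inf finite_codim_mono by blast
  then obtain z where z: "z \<in> ?Z" "z \<noteq> 0" "\<And>l. l \<in> S \<Longrightarrow> z * l \<in> ?Z" by blast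
  have zL: "z * l \<in> ?Z" if "l \<in> ?L" for l
  proof (rule span_bound[of l "S \<union> ?Z" "\<lambda>l. z * l"])
    fix s assume "s \<in> S \<union> ?Z"
    moreover have "z * y \<in> ?Z" if "y \<in> ?Z" for y
    proof -
      have zx: "z * x = x * z" and yx: "y * x = x * y" for x
        using that z(1) by (simp_all add: alg_center_def)
      have "z * y * x = x * (z * y)" for x
        by (metis zx yx mult.assoc)
      then show ?thesis by (simp add: alg_center_def)
    qed
    ultimately show "z * s \<in> ?Z" using z(3) by blast
  qed (use that finZ in \<open>auto simp: subspace_center distrib_left scale_mult_right\<close>)
  have "ad (ad a b) e = 0" for a b e :: 'a
  proof -
    have "z * ad a b \<in> ?Z" using zL ad_in_commutator_subalgebra .
    then have "0 = ad (z * ad a b) e" by (simp add: center_iff_ad)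
    also have "\<dots> = z * ad (ad a b) e"
    proof -
      have "e * (z * ad a b) = z * (e * ad a b)"
        using z(1) unfolding alg_center_def by (metis (mono_tags, lifting) mem_Collect_eq mult.assoc)
      then show ?thesis by (simp add: ad_def[of _ e] right_diff_distrib mult.assoc)
    qed
    finally show ?thesis using central_mult_cancel[OF z(1,2)] by simp
  qed
  then have "ad x (ad x a) = 0" for x a :: 'a by (metis ad_anti neg_equal_0_iff_equal)
  then have "x \<in> ?Z" for x by (intro central_of_ad_ad_zero)
  then show False using noncommutative by (auto simp: alg_center_def)
qed

end

theorem theorem3:
  fixes scale :: "'k::field \<Rightarrow> 'a::ring \<Rightarrow> 'a"
  assumes "assoc_algebra scale"
    and "just_infinite (assoc_alg scale)"
    and "no_torsion scale 2" and "no_torsion scale 3" and "no_torsion scale 5"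
    and "\<exists>x y :: 'a. x * y \<noteq> y * x"
  shows "just_infinite_lie_algebra
    (quotient_alg (commutator_lie_alg scale) (alg_center \<inter> commutator_subalgebra scale))"
proof -
  interpret assoc_algebra scale by fact
  interpret noncommutative_prime_algebra scale
  proof
    show "a = 0 \<or> b = 0" if "\<And>x. a * x * b = 0" for a b :: 'a
      using just_infinite_prime assms(2) that by blast
    show "x = 0" if "x + x = 0" for x :: 'a
    proof -
      have "scale (of_nat 2) x = x + x"
        using scale_left_distrib[of 1 1 x] by simp
      then show ?thesis using assms(3) that unfolding no_torsion_def by metis
    qed
    show "x = 0" if "x + x + x = 0" for x :: 'a
    proof -
      have "scale (of_nat 3) x = x + x + x"
        using scale_left_distrib[of "1 + 1" 1 x] scale_left_distrib[of 1 1 x] by simp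
      then show ?thesis using assms(4) that unfolding no_torsion_def by metis
    qed
  qed (fact assms(6))
  let ?L = "commutator_lie_alg scale"
  define I where "I = alg_center \<inter> commutator_subalgebra scale"
  interpret L: lie_algebra ?L by (rule lie_algebra_commutator)
  have I: "alg_ideal ?L I" unfolding I_def by (rule alg_ideal_center)
  have inf: "\<not> finite_dim (quotient_alg ?L I)"
  proof
    assume "finite_dim (quotient_alg ?L I)"
    then obtain S where S: "finite S" "S \<subseteq> commutator_subalgebra scale"
      "alg_span ?L (S \<union> I) = carrier ?L"
      unfolding L.finite_dim_quotient_iff[OF I] commutator_lie_alg_simps(1) by blast
    then have "commutator_subalgebra scale \<subseteq> span (S \<union> I)"
      using alg_span_commutator_eq_carrier_iff[of "S \<union> I"] by (auto simp: I_def)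
    then show False
      using commutators_mod_center_infinite[OF _ S(1,2)] assms(2)
      by (simp add: just_infinite_assoc_iff I_def)
  qed
  have "finite_dim (quotient_alg (quotient_alg ?L I) W)"
    if W: "alg_ideal (quotient_alg ?L I) W" and W0: "W \<noteq> {zero (quotient_alg ?L I)}" for W
  proof -
    define U where "U = {x \<in> carrier ?L. coset ?L I x \<in> W}"
    have U: "alg_ideal ?L U" unfolding U_def using L.alg_ideal_preimage[OF I W] .
    then have UL: "lie_stable U" "U \<subseteq> commutator_subalgebra scale"
      using ad_in_commutator_subalgebra
      by (auto simp: alg_ideal_def alg_subspace_commutator_iff lie_stable_def commutator_lie_alg_simps)
    have "\<not> U \<subseteq> alg_center"
    proof
      assume c: "U \<subseteq> alg_center"
      have "X = zero (quotient_alg ?L I)" if X: "X \<in> W" for X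
      proof -
        obtain x where x: "x \<in> carrier ?L" "X = coset ?L I x"
          using W X by (auto simp: alg_ideal_def alg_subspace_def L.quotient_carrier[OF I])
        then have "x \<in> I" using c X UL(2) by (auto simp: U_def I_def)
        then have "x \<in> coset ?L I (zero ?L)" by (simp add: coset_def commutator_lie_alg_simps)
        then show ?thesis
          using L.coset_eq[OF I L.zero_closed] x L.quotient_zero[OF I] by simp
      qed
      moreover have "zero (quotient_alg ?L I) \<in> W"
        using W by (auto simp: alg_ideal_def alg_subspace_def)
      ultimately show False using W0 by blast
    qed
    then obtain J where J: "alg_ideal (assoc_alg scale) J" "J \<noteq> {0}" "\<And>x a. x \<in> J \<Longrightarrow> ad x a \<in> U"
      using noncentral_lie_stable_contains_ideal_commutators[OF UL(1)] by blast
    then have "finite_codim UNIV J" using assms(2) by (simp add: just_infinite_assoc_iff)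
    then obtain S where S: "finite S" "S \<subseteq> commutator_subalgebra scale"
      "commutator_subalgebra scale \<subseteq> span (S \<union> U)"
      using finite_codim_commutators[OF _ lie_stableD(1)[OF UL(1)] J(3)] by blast
    then have "alg_span ?L (S \<union> U) = carrier ?L"
      using alg_span_commutator_eq_carrier_iff[of "S \<union> U"] UL(2) by simp
    then show ?thesis
      using L.finite_dim_quotient_quotient[OF I W S(1)] S(2)
      by (simp add: U_def commutator_lie_alg_simps)
  qed
  then show ?thesis
    using inf lie_algebra_commutator_mod_center
    by (simp add: just_infinite_lie_algebra_def just_infinite_def I_def)
qed

end
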